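(* For every uniform matroid $U_{t,n}$ on $[n]=\{x_1,\ldots,x_n\}$ and every $\alpha\in\mathbb{N}^n$, the expansion $U_{t,n}^\alpha$ is a partition matroid. Conversely, every partition matroid is, up to isomorphism, the expansion $U_{t,m}^\alpha$ of some uniform matroid $U_{t,m}$ with respect to some $\alpha\in\mathbb{N}^m$.
   Context: A matroid $M$ is a finite ground set $\mathcal{E}_M$ with a non-empty family $\mathcal{B}_M$ of bases satisfying the exchange property. Here $\mathbb{N}$ denotes the positive integers. Write $[n]=\{x_1,\ldots,x_n\}$ and, for $\alpha=(k_1,\ldots,k_n)\in\mathbb{N}^n$, $[n]^\alpha=\{x_{ij}:1\le i\le n,\ 1\le j\le k_i\}$. For $A=\{x_{i_1},\ldots,x_{i_r}\}\subseteq[n]$ (with $r$ distinct elements) put $\{A\}^\alpha=\{\{x_{i_1j_1},\ldots,x_{i_rj_r}\}:1\le j_l\le k_{i_l}\text{ for all }l\}$, and for a family $\mathcal{A}$ of subsets of $[n]$ put $\mathcal{A}^\alpha=\bigcup_{A\in\mathcal{A}}\{A\}^\alpha$. The expansion $M^\alpha$ of a matroid $M$ on $[n]$ is the matroid with ground set $[n]^\alpha$ and basis set $(\mathcal{B}_M)^\alpha$ (it is known that this is a matroid). For $t\le n$, the uniform matroid $U_{t,n}$ is the matroid on $[n]$ whose bases are all $t$-element subsets of $[n]$. A partition matroid of rank $t$ is a matroid $M(\mathcal{P})$ associated with a partition $\mathcal{P}=\{A_1,\ldots,A_m\}$ of its finite ground set $\mathcal{E}$ into non-empty parts (with $t\le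 m$), whose basis set is $\{U\subseteq\mathcal{E}:|U\cap A_i|\le 1\text{ for all }i\text{ and }|U|=t\}$. *)

theory Defs
  imports "HOL-Library.Disjoint_Sets"
begin

record 'a basis_system =
  ground :: "'a set"
  bases :: "'a set set"

definition matroid :: "'a basis_system \<Rightarrow> bool" where
  "matroid M \<longleftrightarrow>
     finite (ground M) \<and> bases M \<noteq> {} \<and> bases M \<subseteq> Pow (ground M) \<and>
     (\<forall>B \<in> bases M. \<forall>C \<in> bases M. \<forall>x \<in> B - C. \<exists>y \<in> C - B. insert y (B - {x}) \<in> bases M)"

definition isomorphic :: "'a basis_system \<Rightarrow> 'b basis_system \<Rightarrow> bool" where
  "isomorphic M N \<longleftrightarrow>
     (\<exists>f. bij_betw f (ground M) (ground N) \<and> (\<lambda>B. f ` B) ` bases M = bases N)"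

text \<open>
  The copy \<open>x\<^sub>i\<^sub>j\<close> of an element \<open>x\<^sub>i\<close> is the pair of \<open>x\<^sub>i\<close> and \<open>j\<close>. A vector \<open>\<alpha>\<close> of
  multiplicities is a function of which only the values on the ground set are used.
\<close>

definition ground_expansion :: "('a \<Rightarrow> nat) \<Rightarrow> 'a set \<Rightarrow> ('a \<times> nat) set" where
  "ground_expansion \<alpha> E = {(x, j). x \<in> E \<and> 1 \<le> j \<and> j \<le> \<alpha> x}"

text \<open>
  An element of \<open>{A}\<^sup>\<alpha>\<close> picks exactly one copy of each element of \<open>A\<close>; the function \<open>j\<close>
  records the choice of the indices.
\<close>

definition set_expansion :: "('a \<Rightarrow> nat) \<Rightarrow> 'a set \<Rightarrow> ('a \<times> nat) set set" where
  "set_expansion \<alpha> A = {(\<lambda>x. (x, j x)) ` A | j. \<forall>x \<in> A. 1 \<le> j x \<and> j x \<le> \<alpha> x}"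

definition family_expansion :: "('a \<Rightarrow> nat) \<Rightarrow> 'a set set \<Rightarrow> ('a \<times> nat) set set" where
  "family_expansion \<alpha> \<A> = (\<Union>A \<in> \<A>. set_expansion \<alpha> A)"

definition expansion :: "('a \<Rightarrow> nat) \<Rightarrow> 'a basis_system \<Rightarrow> ('a \<times> nat) basis_system" where
  "expansion \<alpha> M =
     \<lparr>ground = ground_expansion \<alpha> (ground M), bases = family_expansion \<alpha> (bases M)\<rparr>"

text \<open>
  The ground set \<open>[n]\<close> is rendered by its index set. The definition is only meaningful
  for \<open>t \<le> n\<close>, since otherwise there are no bases.
\<close>

definition uniform_matroid :: "nat \<Rightarrow> nat \<Rightarrow> nat basis_system" where
  "uniform_matroid t n = \<lparr>ground = {1..n}, bases = {B. B \<subseteq> {1..n} \<and> card B = t}\<rparr>"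

definition partition_matroid :: "'a basis_system \<Rightarrow> bool" where
  "partition_matroid M \<longleftrightarrow> matroid M \<and>
     (\<exists>P t. partition_on (ground M) P \<and> t \<le> card P \<and>
        bases M = {U. U \<subseteq> ground M \<and> (\<forall>A \<in> P. card (U \<inter> A) \<le> 1) \<and> card U = t})"

lemma matroid_uniform_matroid:
  assumes "t \<le> n"
  shows "matroid (uniform_matroid t n)"
proof -
  have "\<exists>B \<subseteq> {1..n}. card B = t"
    using obtain_subset_with_card_n[of t "{1..n}"] assms by auto
  moreover have "\<exists>y \<in> C - B. insert y (B - {x}) \<subseteq> {1..n} \<and> card (insert y (B - {x})) = t"
    if B: "B \<subseteq> {1..n}" "card B = t" and C: "C \<subseteq> {1..n}" "card C = t" and x: "x \<in> B - C" for B C x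
  proof -
    have fin: "finite B" "finite C"
      using B C finite_subset finite_atLeastAtMost by blast+
    have "\<not> C \<subseteq> B" using card_subset_eq[of B C] fin B C x by auto
    then obtain y where y: "y \<in> C - B" by auto
    have "card (insert y (B - {x})) = t"
      using fin B x y card_Suc_Diff1[of B x] by simp
    then show ?thesis
      using y B C by (intro bexI[of _ y]) auto
  qed
  ultimately show ?thesis
    unfolding matroid_def uniform_matroid_def by simp blast
qed

text \<open>
  The conjunct \<^term>\<open>matroid M\<close> in the definition of partition matroids is redundant for a
  finite ground set.
\<close>

lemma partition_matroid_iff:
  "partition_matroid M \<longleftrightarrow> finite (ground M) \<and>
     (\<exists>P t. partition_on (ground M) P \<and> t \<le> card P \<and>
        bases M = {U. U \<subseteq> ground M \<and> (\<forall>A \<in> P. card (U \<inter> A) \<le> 1) \<and> card U = t})"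
proof -
  have "matroid M"
    if fin: "finite (ground M)" and P: "partition_on (ground M) P" and t: "t \<le> card P"
      and bs: "bases M = {U. U \<subseteq> ground M \<and> (\<forall>A \<in> P. card (U \<inter> A) \<le> 1) \<and> card U = t}"
    for P t
  proof -
    define E where "E = ground M"
    define p where "p = (\<lambda>x. THE A. A \<in> P \<and> x \<in> A)"
    have PE: "\<Union>P = E" and dis: "\<And>A B. A \<in> P \<Longrightarrow> B \<in> P \<Longrightarrow> A \<noteq> B \<Longrightarrow> A \<inter> B = {}"
      and ne: "\<And>A. A \<in> P \<Longrightarrow> A \<noteq> {}"
      using P unfolding partition_on_def E_def disjoint_def by auto
    have p_eq: "p x = A" if "A \<in> P" "x \<in> A" for x A
      unfolding p_def using that dis by (intro the_equality) blast+
    have p: "p x \<in> P \<and> x \<in> p x" if "x \<in> E" for x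
      using that PE p_eq by auto
    have finE: "finite E" using fin E_def by simp
    have base: "U \<in> bases M \<longleftrightarrow> U \<subseteq> E \<and> inj_on p U \<and> card U = t" for U
    proof -
      have "(\<forall>A \<in> P. card (U \<inter> A) \<le> 1) \<longleftrightarrow> inj_on p U" if U: "U \<subseteq> E"
      proof -
        have "finite U" using U finE finite_subset by blast
        then have "(\<forall>A \<in> P. card (U \<inter> A) \<le> 1) \<longleftrightarrow>
            (\<forall>A \<in> P. \<forall>x \<in> U \<inter> A. \<forall>y \<in> U \<inter> A. x = y)"
          by (simp add: card_le_Suc0_iff_eq)
        also have "\<dots> \<longleftrightarrow> inj_on p U"
        proof
          assume *: "\<forall>A \<in> P. \<forall>x \<in> U \<inter> A. \<forall>y \<in> U \<inter> A. x = y"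
          show "inj_on p U"
          proof (rule inj_onI)
            fix x y assume "x \<in> U" "y \<in> U" "p x = p y"
            then show "x = y" using * p[of x] p[of y] U by auto
          qed
        next
          assume "inj_on p U"
          then show "\<forall>A \<in> P. \<forall>x \<in> U \<inter> A. \<forall>y \<in> U \<inter> A. x = y"
            by (metis IntE inj_onD p_eq)
        qed
        finally show ?thesis .
      qed
      then show ?thesis unfolding bs E_def by blast
    qed
    have "bases M \<noteq> {}"
    proof -
      obtain Q where Q: "Q \<subseteq> P" "card Q = t" using t obtain_subset_with_card_n by metis
      obtain r where r: "\<And>A. A \<in> P \<Longrightarrow> r A \<in> A" using ne by (metis ex_in_conv)
      have pr: "p (r A) = A" if "A \<in> Q" for A using that Q r p_eq by blast
      have "inj_on r Q" using pr by (metis inj_onI)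
      then have "card (r ` Q) = t" using Q by (simp add: card_image)
      moreover have "r ` Q \<subseteq> E" using Q r PE by blast
      moreover have "inj_on p (r ` Q)" using pr by (auto simp: inj_on_def)
      ultimately have "r ` Q \<in> bases M" unfolding base by blast
      then show ?thesis by auto
    qed
    moreover have "\<exists>y \<in> C - B. insert y (B - {x}) \<in> bases M"
      if B: "B \<in> bases M" and C: "C \<in> bases M" and x: "x \<in> B - C" for B C x
    proof -
      have finB: "finite B" and finC: "finite C"
        using B C base finE finite_subset by blast+
      have Bt: "B \<subseteq> E" "inj_on p B" "card B = t" and Ct: "C \<subseteq> E" "inj_on p C" "card C = t"
        using B C unfolding base by auto
      have "card (p ` (B - {x})) < card (p ` C)"
        using Bt Ct x finB card_Diff1_less[of B x] card_image_le[of "B - {x}" p]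
        by (simp add: card_image)
      then have "\<not> p ` C \<subseteq> p ` (B - {x})"
        using card_mono[of "p ` (B - {x})" "p ` C"] finB by auto
      then obtain y where y: "y \<in> C" "p y \<notin> p ` (B - {x})" by auto
      have yB: "y \<notin> B" using y x by auto
      have "card (insert y (B - {x})) = t"
        using finB Bt x yB card_Suc_Diff1[of B x] by simp
      moreover have "inj_on p (insert y (B - {x}))"
        using y Bt by (auto intro: inj_on_diff)
      ultimately have "insert y (B - {x}) \<in> bases M"
        using y Bt Ct unfolding base by blast
      then show ?thesis using y yB by blast
    qed
    ultimately show ?thesis unfolding matroid_def using fin bs by blast
  qed
  note main = this
  show ?thesis (is "_ \<longleftrightarrow> _ \<and> ?ex")
  proof
    assume "partition_matroid M"
    then show "finite (ground M) \<and> ?ex"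
      unfolding partition_matroid_def by (elim conjE, intro conjI) (simp_all only: matroid_def)
  next
    assume *: "finite (ground M) \<and> ?ex"
    then have "matroid M" by (elim conjE exE) (rule main)
    with * show "partition_matroid M"
      unfolding partition_matroid_def by (elim conjE, intro conjI)
  qed
qed

end

theory Submission
  imports Defs
begin

text \<open>
  A set of copies is a basis of \<open>U\<^sub>t\<^sub>,\<^sub>n\<^sup>\<alpha>\<close> iff it has \<open>t\<close> elements and the projection
  \<open>x\<^sub>i\<^sub>j \<mapsto> x\<^sub>i\<close> is injective on it. A basis of a partition matroid is a \<open>t\<close>-set on which
  the map sending an element to its part is injective. So the parts correspond to the elements
  of \<open>[n]\<close>, and the sizes of the parts to the entries of \<open>\<alpha>\<close>.
\<close>

text \<open>Replaces the choice of indices by conditions on \<open>U\<close> alone: a set of copies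
  on which \<open>fst\<close> is injective is the graph of a function on its projection, and that
  function is the choice.\<close>

lemma mem_set_expansion_iff:
  "U \<in> set_expansion \<alpha> A \<longleftrightarrow> U \<subseteq> ground_expansion \<alpha> A \<and> inj_on fst U \<and> fst ` U = A"
proof
  assume "U \<in> set_expansion \<alpha> A"
  then show "U \<subseteq> ground_expansion \<alpha> A \<and> inj_on fst U \<and> fst ` U = A"
    unfolding set_expansion_def ground_expansion_def by (force simp: inj_on_def image_image)
next
  assume *: "U \<subseteq> ground_expansion \<alpha> A \<and> inj_on fst U \<and> fst ` U = A"
  \<comment> \<open>The index of the only copy of \<open>x\<close> in \<open>U\<close>; the value is
    meaningful only for \<open>x\<close> in \<open>A\<close>, the projection of
    \<open>U\<close>.\<close>
  define j where "j x = snd (the_inv_into U fst x)" for x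
  have j: "j (fst u) = snd u" if "u \<in> U" for u
    using * that by (simp add: j_def the_inv_into_f_f)
  have "(\<lambda>x. (x, j x)) ` A = (\<lambda>x. (x, j x)) ` (fst ` U)"
    using * by simp
  also have "\<dots> = (\<lambda>u. (fst u, j (fst u))) ` U"
    by (rule image_image)
  also have "\<dots> = (\<lambda>u. u) ` U"
    by (rule image_cong) (simp_all add: j)
  finally have "(\<lambda>x. (x, j x)) ` A = U"
    by simp
  moreover have "\<forall>x \<in> A. 1 \<le> j x \<and> j x \<le> \<alpha> x"
    using * j unfolding ground_expansion_def by fastforce
  ultimately show "U \<in> set_expansion \<alpha> A"
    unfolding set_expansion_def by blast
qed

lemma ground_expansion_uniform_matroid:
  "ground (expansion \<alpha> (uniform_matroid t n)) = (SIGMA i:{1..n}. {1..\<alpha> i})"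
  by (auto simp: expansion_def uniform_matroid_def ground_expansion_def)

lemma bases_expansion_uniform_matroid:
  "bases (expansion \<alpha> (uniform_matroid t n)) =
     {U. U \<subseteq> (SIGMA i:{1..n}. {1..\<alpha> i}) \<and> inj_on fst U \<and> card U = t}"
proof -
  have "U \<in> bases (expansion \<alpha> (uniform_matroid t n)) \<longleftrightarrow>
      U \<subseteq> (SIGMA i:{1..n}. {1..\<alpha> i}) \<and> inj_on fst U \<and> card U = t" for U
  proof -
    \<comment> \<open>The \<open>t\<close>-set whose expansion contains \<open>U\<close> can only be
      the projection of \<open>U\<close>, so the union over all bases collapses to a condition on
      that projection.\<close>
    have "U \<in> bases (expansion \<alpha> (uniform_matroid t n)) \<longleftrightarrow>
        (fst ` U \<subseteq> {1..n} \<and> U \<subseteq> ground_expansion \<alpha> (fst ` U)) \<and>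
        inj_on fst U \<and> card (fst ` U) = t"
      by (auto simp: expansion_def uniform_matroid_def family_expansion_def mem_set_expansion_iff)
    also have "fst ` U \<subseteq> {1..n} \<and> U \<subseteq> ground_expansion \<alpha> (fst ` U) \<longleftrightarrow>
        U \<subseteq> (SIGMA i:{1..n}. {1..\<alpha> i})"
      unfolding ground_expansion_def by force
    finally show ?thesis
      using card_image by metis
  qed
  then show ?thesis
    by blast
qed

text \<open>The third assumption says that the fibres of \<open>p\<close> on the ground set are
  exactly the parts, so meeting each part at most once means that no two elements share a value of
  \<open>p\<close>. Keeping \<open>p\<close> abstract lets the lemma serve both directions of the
  theorem.\<close>

lemma partial_transversal_iff_inj_on:
  assumes fin: "finite U" and U: "U \<subseteq> \<Union>P"
    and p: "\<And>A x y. A \<in> P \<Longrightarrow> x \<in> A \<Longrightarrow> y \<in> \<Union>P \<Longrightarrow> p x = p y \<longleftrightarrow> y \<in> A"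
  shows "(\<forall>A \<in> P. card (U \<inter> A) \<le> 1) \<longleftrightarrow> inj_on p U"
proof -
  have "(\<forall>A \<in> P. card (U \<inter> A) \<le> 1) \<longleftrightarrow> (\<forall>A \<in> P. \<forall>x \<in> U \<inter> A. \<forall>y \<in> U \<inter> A. x = y)"
    using fin by (simp add: card_le_Suc0_iff_eq)
  also have "\<dots> \<longleftrightarrow> inj_on p U"
  proof
    assume *: "\<forall>A \<in> P. \<forall>x \<in> U \<inter> A. \<forall>y \<in> U \<inter> A. x = y"
    show "inj_on p U"
    proof (rule inj_onI)
      fix x y assume xy: "x \<in> U" "y \<in> U" "p x = p y"
      then obtain A where "A \<in> P" "x \<in> A" using U by blast
      then show "x = y" using * p[of A x y] xy U by blast
    qed
  next
    assume "inj_on p U"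
    then show "\<forall>A \<in> P. \<forall>x \<in> U \<inter> A. \<forall>y \<in> U \<inter> A. x = y"
      using p by (metis IntE UnionI inj_onD)
  qed
  finally show ?thesis .
qed

lemma partition_matroid_expansion_uniform_matroid:
  assumes t: "t \<le> n" and \<alpha>: "\<forall>i \<in> {1..n}. 1 \<le> \<alpha> i"
  shows "partition_matroid (expansion \<alpha> (uniform_matroid t n))"
proof -
  define E where "E = (SIGMA i:{1..n}. {1..\<alpha> i})"
  define F where "F i = {i} \<times> {1..\<alpha> i}" for i
  define P where "P = F ` {1..n}"
  have finE: "finite E"
    by (simp add: E_def)
  \<comment> \<open>Positivity of \<alpha> enters here: each fibre contains a first copy. Hence the
    fibres are non-empty, and they are pairwise distinct, so there are exactly \<open>n\<close>
    parts and \<open>t\<close> is at most their number.\<close>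
  have ne: "(i, 1) \<in> F i" if "i \<in> {1..n}" for i
    using \<alpha> that by (simp add: F_def)
  have PE: "\<Union>P = E"
    by (auto simp: P_def E_def F_def)
  have part: "partition_on E P"
  proof (rule partition_onI)
    show "\<Union>P = E" by (rule PE)
    show "disjnt A B" if "A \<in> P" "B \<in> P" "A \<noteq> B" for A B
      using that by (auto simp: P_def F_def disjnt_def)
    show "{} \<notin> P"
      using ne unfolding P_def by force
  qed
  have "inj_on F {1..n}"
  proof (rule inj_onI)
    fix i k assume "i \<in> {1..n}" "F i = F k"
    then have "(i, 1) \<in> F k" using ne by blast
    then show "i = k" by (simp add: F_def)
  qed
  then have "card P = n"
    by (simp add: P_def card_image)
  moreover have "(\<forall>A \<in> P. card (U \<inter> A) \<le> 1) \<longleftrightarrow> inj_on fst U" if "U \<subseteq> E" for U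
    using that finE PE by (intro partial_transversal_iff_inj_on)
      (auto simp: P_def F_def E_def dest: finite_subset)
  ultimately show ?thesis
    unfolding partition_matroid_iff ground_expansion_uniform_matroid
      bases_expansion_uniform_matroid E_def[symmetric]
    using finE part t by (intro conjI exI[of _ P] exI[of _ t]) auto
qed

text \<open>Number the parts, and number the elements inside each part. Sending an element to the
  pair of its part's number and its own number is the isomorphism.\<close>

lemma partition_matroid_imp_isomorphic_expansion:
  assumes "partition_matroid M"
  shows "\<exists>t m \<alpha>. t \<le> m \<and> (\<forall>i \<in> {1..m}. 1 \<le> \<alpha> i) \<and>
    isomorphic M (expansion \<alpha> (uniform_matroid t m))"
proof -
  define E where "E = ground M"
  obtain P t where finE: "finite E" and part: "partition_on E P" and t: "t \<le> card P"
    and bs: "bases M = {U. U \<subseteq> E \<and> (\<forall>A \<in> P. card (U \<inter> A) \<le> 1) \<and> card U = t}"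
    using assms unfolding partition_matroid_iff E_def by blast
  have PE: "\<Union>P = E" and ne: "\<And>A. A \<in> P \<Longrightarrow> A \<noteq> {}"
    and dis: "\<And>A B x. A \<in> P \<Longrightarrow> B \<in> P \<Longrightarrow> x \<in> A \<Longrightarrow> x \<in> B \<Longrightarrow> A = B"
    using part unfolding partition_on_def disjoint_def by auto
  have finP: "finite P"
    using finE PE by (simp add: finite_UnionD)
  have finA: "finite A" if "A \<in> P" for A
    using that finE PE by (metis Union_upper finite_subset)
  define m where "m = card P"
  obtain g where g: "bij_betw g {1..m} P"
    using ex_bij_betw_nat_finite_1[OF finP] m_def by blast
  define \<alpha> where "\<alpha> i = card (g i)" for i
  have gP: "g i \<in> P" if "i \<in> {1..m}" for i
    using g that by (rule bij_betwE[rule_format])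
  have "\<exists>h. bij_betw h (g i) {1..\<alpha> i}" if "i \<in> {1..m}" for i
    unfolding \<alpha>_def
    by (intro finite_same_card_bij) (simp_all add: finA[OF gP[OF that]])
  then obtain h where h: "\<And>i. i \<in> {1..m} \<Longrightarrow> bij_betw (h i) (g i) {1..\<alpha> i}"
    by metis
  have "\<exists>i. i \<in> {1..m} \<and> x \<in> g i" if "x \<in> E" for x
    using that PE bij_betw_imp_surj_on[OF g] by blast
  then obtain q where q: "\<And>x. x \<in> E \<Longrightarrow> q x \<in> {1..m} \<and> x \<in> g (q x)"
    by metis
  \<comment> \<open>Disjoint parts and an injective \<open>g\<close> leave only one possible number
    for the part containing \<open>x\<close>.\<close>
  have q_eq: "q x = i" if "i \<in> {1..m}" "x \<in> g i" for i x
    using that q[of x] dis gP PE bij_betw_imp_inj_on[OF g] by (metis UnionI inj_onD)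
  define f where "f x = (q x, h (q x) x)" for x
  have inj: "inj_on f E"
  proof (rule inj_onI)
    fix x y assume "x \<in> E" "y \<in> E" "f x = f y"
    \<comment> \<open>Equal first coordinates put \<open>x\<close> and \<open>y\<close> in the same
      part, where the numbering \<open>h (q x)\<close> separates them.\<close>
    then show "x = y"
      using q bij_betw_imp_inj_on[OF h] unfolding f_def by (metis Pair_inject inj_onD)
  qed
  have img: "f ` E = (SIGMA i:{1..m}. {1..\<alpha> i})" (is "_ = ?G")
  proof
    show "f ` E \<subseteq> ?G"
    proof
      fix z assume "z \<in> f ` E"
      then obtain x where x: "x \<in> E" "z = f x" by blast
      then show "z \<in> ?G"
        using q[OF x(1)] bij_betwE[OF h[of "q x"]] by (simp add: f_def)
    qed
    show "?G \<subseteq> f ` E"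
    proof
      fix z assume "z \<in> ?G"
      then obtain i j where z: "z = (i, j)" "i \<in> {1..m}" "j \<in> {1..\<alpha> i}" by blast
      then have "j \<in> h i ` g i"
        using bij_betw_imp_surj_on[OF h] by simp
      then obtain x where x: "x \<in> g i" "h i x = j" by blast
      have "x \<in> E"
        using x(1) gP[OF z(2)] PE by blast
      moreover have "f x = z"
        using z(1) x(2) q_eq[OF z(2) x(1)] by (simp add: f_def)
      ultimately show "z \<in> f ` E" by blast
    qed
  qed
  have fst_f: "fst \<circ> f = q"
    by (auto simp: f_def)
  \<comment> \<open>The map \<open>f\<close> is injective and \<open>fst\<close> after
    \<open>f\<close> is \<open>q\<close>, so both cardinality and injectivity on parts pass between
    \<open>U\<close> and its image.\<close>
  have base: "(\<forall>A \<in> P. card (U \<inter> A) \<le> 1) \<and> card U = t \<longleftrightarrow>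
      inj_on fst (f ` U) \<and> card (f ` U) = t" if U: "U \<subseteq> E" for U
  proof -
    have injU: "inj_on f U"
      using inj U inj_on_subset by blast
    have "(\<forall>A \<in> P. card (U \<inter> A) \<le> 1) \<longleftrightarrow> inj_on q U"
    proof (rule partial_transversal_iff_inj_on)
      show "finite U" "U \<subseteq> \<Union>P"
        using U finE PE finite_subset by auto
      show "q x = q y \<longleftrightarrow> y \<in> A" if "A \<in> P" "x \<in> A" "y \<in> \<Union>P" for A x y
        using that PE q q_eq dis gP by (metis UnionI)
    qed
    also have "\<dots> \<longleftrightarrow> inj_on fst (f ` U)"
      using comp_inj_on_iff[OF injU, of fst] fst_f by simp
    finally show ?thesis
      by (simp add: card_image injU)
  qed
  \<comment> \<open>Every subset of the image of \<open>E\<close> is the image of some subset of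
    \<open>E\<close>, so \<open>base\<close> turns the description of the bases of \<open>M\<close>
    into that of the expansion.\<close>
  have "(\<lambda>B. f ` B) ` bases M = {V. V \<subseteq> f ` E \<and> inj_on fst V \<and> card V = t}"
    unfolding bs using base by (auto simp: subset_image_iff)
  then have "isomorphic M (expansion \<alpha> (uniform_matroid t m))"
    unfolding isomorphic_def ground_expansion_uniform_matroid bases_expansion_uniform_matroid
    using inj img by (intro exI[of _ f]) (simp add: bij_betw_def E_def)
  moreover have "\<forall>i \<in> {1..m}. 1 \<le> \<alpha> i"
    using gP finA ne by (simp add: \<alpha>_def Suc_le_eq card_gt_0_iff)
  ultimately show ?thesis
    using t m_def by blast
qed

theorem theorem2p9:
  "(\<forall>t n (\<alpha> :: nat \<Rightarrow> nat).
      t \<le> n \<and> (\<forall>i \<in> {1..n}. 1 \<le> \<alpha> i) \<longrightarrow>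
      partition_matroid (expansion \<alpha> (uniform_matroid t n))) \<and>
   (\<forall>M :: 'a basis_system.
      partition_matroid M \<longrightarrow>
      (\<exists>t m (\<alpha> :: nat \<Rightarrow> nat).
         t \<le> m \<and> (\<forall>i \<in> {1..m}. 1 \<le> \<alpha> i) \<and>
         isomorphic M (expansion \<alpha> (uniform_matroid t m))))"
  using partition_matroid_expansion_uniform_matroid partition_matroid_imp_isomorphic_expansion
  by blast

end
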